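(* Let $p$ be an odd prime and let $P$ be a finite $p$-group of coexponent $f(P) \geq 1$. Then the nilpotency class of $P$ satisfies $\mathrm{cl}(P) \leq 2 f(P)$.
   Context: For a prime $p$ and a finite $p$-group $P$, the coexponent of $P$ is the least integer $f(P)$ such that $P$ possesses a cyclic subgroup of index $p^{f(P)}$. $\mathrm{cl}(P)$ denotes the nilpotency class of $P$. *)

theory Defs
  imports "HOL-Algebra.Algebra" "HOL-Computational_Algebra.Primes"
begin

text \<open>
  Terms are numbered from \<open>0\<close>: the value at \<open>n\<close> is the term usually written
  \<open>\<gamma>\<^sub>n\<^sub>+\<^sub>1(G) = [\<gamma>\<^sub>n(G), G]\<close>, with commutators \<open>x y x\<^sup>-\<^sup>1 y\<^sup>-\<^sup>1\<close> as in
  \<^const>\<open>derived\<close>.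
\<close>
primrec lower_central :: "('a, 'b) monoid_scheme \<Rightarrow> nat \<Rightarrow> 'a set" where
  "lower_central G 0 = carrier G"
| "lower_central G (Suc n) =
     generate G (\<Union>x \<in> lower_central G n. \<Union>y \<in> carrier G.
       {x \<otimes>\<^bsub>G\<^esub> y \<otimes>\<^bsub>G\<^esub> inv\<^bsub>G\<^esub> x \<otimes>\<^bsub>G\<^esub> inv\<^bsub>G\<^esub> y})"

text \<open>
  Meaningful only for nilpotent \<open>G\<close>, in particular for finite \<open>p\<close>-groups; otherwise the
  \<open>LEAST\<close> ranges over no number and its value is unspecified.
\<close>
definition nilpotency_class :: "('a, 'b) monoid_scheme \<Rightarrow> nat" where
  "nilpotency_class G = (LEAST c. lower_central G c = {\<one>\<^bsub>G\<^esub>})"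

text \<open>
  Meant for finite \<open>p\<close>-groups, where the trivial subgroup shows that the \<open>LEAST\<close> exists.
  The index of \<open>C\<close> is the number of its right cosets.
\<close>
definition coexponent :: "nat \<Rightarrow> ('a, 'b) monoid_scheme \<Rightarrow> nat" where
  "coexponent p G =
     (LEAST k. \<exists>C. subgroup C G \<and> cyclic_group (G\<lparr>carrier := C\<rparr>) \<and> card (rcosets\<^bsub>G\<^esub> C) = p ^ k)"

end

theory Submission
  imports Defs "HOL-Number_Theory.Residues"
begin

text \<open>
  Let \<open>\<langle>x\<rangle>\<close> have index \<open>p\<^sup>f\<close> in the noncyclic group \<open>G\<close>. There are normal subgroups \<open>D \<le> E\<close>
  with \<open>[E, G] \<le> D\<close>, \<open>[D, G] = 1\<close> and \<open>E\<close> not contained in \<open>\<langle>x\<rangle>\<close>. The image of \<open>x\<close> in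
  \<open>G/E\<close> generates a subgroup of index at most \<open>p\<^sup>f\<^sup>-\<^sup>1\<close>, while \<open>E\<close> adds at most \<open>2\<close> to the class,
  so induction gives \<open>2f\<close>. It starts at \<open>f = 1\<close>: there \<open>G/E\<close> is cyclic and \<open>E/D\<close> is central in \<open>G/D\<close>,
  so \<open>G/D\<close> is abelian and \<open>G\<close> has class at most \<open>2\<close>.

  To find \<open>D\<close> and \<open>E\<close>, take a noncyclic normal subgroup \<open>N\<close> of least order and a maximal
  \<open>G\<close>-normal proper subgroup \<open>M\<close> of \<open>N\<close>; it is cyclic, of index \<open>p\<close> in \<open>N\<close>. Let \<open>D\<close> be the subgroup of
  order \<open>p\<close> of \<open>M\<close>. As \<open>p\<close> is odd, \<open>[N, N] \<le> D\<close>, so that \<open>g \<mapsto> g\<^sup>p\<close> is an endomorphism of \<open>N\<close>, and its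
  kernel \<open>F\<close> is not contained in \<open>M\<close>. Hence \<open>F - D\<close> contains an element \<open>e\<close> central modulo \<open>D\<close>. Since a
  cyclic group has at most \<open>p\<close> solutions of \<open>g\<^sup>p = 1\<close>, the group \<open>\<langle>x\<rangle>\<close> cannot contain both \<open>D\<close> and \<open>e\<close>;
  let \<open>E/D\<close> be the center of \<open>G/D\<close>.

  In the induction, quotients are replaced by normal subgroups \<open>K\<close> of one fixed group, because the
  type of the elements changes when passing to a quotient.
\<close>

section \<open>Elements with trivial p-th power modulo a power of p\<close>

text \<open>Fermat gives r = 1 mod p, and r^p - 1 = (r - 1) S with S = 1 + r + ... + r^(p-1). For
  odd p the factor S is p times a number prime to p, so p^k divides p (r - 1). Later
  \<open>r'\<close> is the exponent by which an element acts on a cyclic group of order p^k.\<close>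

lemma odd_prime_power_cong_mult:
  fixes p k r' :: nat
  assumes p: "Factorial_Ring.prime p" and "odd p" and k: "k > 0"
    and cong: "[r' ^ p = 1] (mod p ^ k)"
  shows "[p * r' = p] (mod p ^ k)"
proof -
  define r where "r = int r'"
  have dvd: "int p ^ k dvd r ^ p - 1"
    using cong by (simp add: r_def cong_iff_dvd_diff flip: cong_int_iff)
  then have "int p dvd r ^ p - 1" using k by (meson dvd_power dvd_trans)
  moreover have "[r' ^ p = r'] (mod p)"
  proof (cases "p dvd r'")
    case True
    then have "p dvd r' ^ p" using prime_gt_0_nat[OF p] prime_dvd_power_iff[OF p] by blast
    with True show ?thesis by (simp add: cong_def mod_eq_0_iff_dvd)
  next
    case False
    then have "[r' * r' ^ (p - 1) = r' * 1] (mod p)"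
      using fermat_theorem[OF p False] cong_scalar_left by blast
    then show ?thesis using prime_gt_0_nat[OF p] by (simp flip: power_Suc)
  qed
  then have "int p dvd r ^ p - r"
    by (simp add: r_def cong_iff_dvd_diff flip: cong_int_iff)
  ultimately have "int p dvd (r ^ p - 1) - (r ^ p - r)" by (rule dvd_diff)
  then obtain t where "r - 1 = int p * t" by auto
  then have t: "r = 1 + int p * t" by simp
  define S where "S = (\<Sum>i<p. r ^ i)"
  \<comment> \<open>First-order binomial expansion of (1 + p t)^i; the later terms contain
    p^2.\<close>
  have pw: "[r ^ i = 1 + int i * (int p * t)] (mod (int p)^2)" for i
  proof (induction i)
    case (Suc i)
    have "[r * r ^ i = r * (1 + int i * (int p * t))] (mod (int p)^2)"
      using Suc by (rule cong_scalar_left)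
    also have "r * (1 + int i * (int p * t)) =
        1 + int (Suc i) * (int p * t) + int i * t^2 * (int p)^2"
      by (simp add: t algebra_simps power2_eq_square)
    also have "[\<dots> = 1 + int (Suc i) * (int p * t)] (mod (int p)^2)"
      by (simp add: cong_def)
    finally show ?case by simp
  qed auto
  \<comment> \<open>Here odd \<open>p\<close> enters: the linear terms of S add up to p t times p (p
    - 1) / 2, a multiple of p^2.\<close>
  have gauss: "(\<Sum>i<p. int i) = int p * ((int p - 1) div 2)"
  proof -
    obtain m where m: "p = 2 * m + 1" using \<open>odd p\<close> oddE by blast
    have "2 * (\<Sum>i<q. int i) = int q * (int q - 1)" for q
      by (induction q) (auto simp: algebra_simps)
    from this[of p] show ?thesis using m by simp
  qed
  have "[S = (\<Sum>i<p. 1 + int i * (int p * t))] (mod (int p)^2)"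
    unfolding S_def by (intro cong_sum pw)
  also have "(\<Sum>i<p. 1 + int i * (int p * t)) = int p + (int p)^2 * (((int p - 1) div 2) * t)"
    by (simp add: sum.distrib gauss power2_eq_square flip: sum_distrib_right)
  also have "[\<dots> = int p] (mod (int p)^2)"
    by (simp add: cong_def)
  finally have S: "[S = int p] (mod (int p)^2)" .
  then obtain u where u: "S = int p * (1 + int p * u)"
  proof -
    have "(int p)^2 dvd S - int p" using S by (simp add: cong_iff_dvd_diff)
    then obtain u where "S - int p = (int p)^2 * u" by blast
    then show ?thesis using that[of u] by (simp add: algebra_simps power2_eq_square)
  qed
  have "r ^ p - 1 = (r - 1) * S" unfolding S_def by (simp add: power_diff_1_eq)
  then have "int p ^ k dvd int p * (r - 1) * (1 + int p * u)"
    using dvd u by (simp add: mult_ac)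
  moreover have "coprime (int p ^ k) (1 + int p * u)"
  proof -
    have "gcd (int p) (u * int p + 1) = 1" by (simp only: gcd_add_mult gcd_1_int)
    then have "coprime (int p) (1 + int p * u)"
      by (simp add: coprime_iff_gcd_eq_1 mult.commute add.commute)
    then show ?thesis by simp
  qed
  ultimately have "int p ^ k dvd int p * (r - 1)" using coprime_dvd_mult_left_iff by blast
  then show ?thesis
    by (simp add: r_def cong_iff_dvd_diff right_diff_distrib flip: cong_int_iff)
qed

section \<open>Commutators and powers\<close>

text \<open>The same convention as in \<open>lower_central\<close>, so that unfolding it matches the
  generators there.\<close>

definition commutator :: "('a, 'b) monoid_scheme \<Rightarrow> 'a \<Rightarrow> 'a \<Rightarrow> 'a" where
  "commutator G x y = x \<otimes>\<^bsub>G\<^esub> y \<otimes>\<^bsub>G\<^esub> inv\<^bsub>G\<^esub> x \<otimes>\<^bsub>G\<^esub> inv\<^bsub>G\<^esub> y"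

context group
begin

lemma commutator_closed [simp]:
  "x \<in> carrier G \<Longrightarrow> y \<in> carrier G \<Longrightarrow> commutator G x y \<in> carrier G"
  by (simp add: commutator_def)

lemma commutator_mult:
  assumes "x \<in> carrier G" "y \<in> carrier G"
  shows "x \<otimes> y = commutator G x y \<otimes> (y \<otimes> x)"
  using assms by (simp add: commutator_def m_assoc inv_solve_left')

lemma commutator_eq_iff:
  assumes "x \<in> carrier G" "y \<in> carrier G" "c \<in> carrier G"
  shows "commutator G x y = c \<longleftrightarrow> x \<otimes> y = c \<otimes> (y \<otimes> x)"
  using assms commutator_mult[of x y] by (metis commutator_closed m_closed r_cancel)

lemma mult_inv_cancel:
  assumes "x \<in> carrier G" "y \<in> carrier G"
  shows "x \<otimes> (inv x \<otimes> y) = y" "inv x \<otimes> (x \<otimes> y) = y"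
  using assms by (simp_all flip: m_assoc)

lemma commutator_self [simp]: "x \<in> carrier G \<Longrightarrow> commutator G x x = \<one>"
  by (simp add: commutator_eq_iff)

lemma inv_commutator:
  assumes "x \<in> carrier G" "y \<in> carrier G"
  shows "inv (commutator G x y) = commutator G y x"
  using assms by (simp add: commutator_def inv_mult_group m_assoc)

lemma commutator_eq_one_iff:
  assumes "x \<in> carrier G" "y \<in> carrier G"
  shows "commutator G x y = \<one> \<longleftrightarrow> x \<otimes> y = y \<otimes> x"
  using assms by (simp add: commutator_eq_iff)

lemma commutator_in_sym:
  assumes "subgroup D G" "x \<in> carrier G" "y \<in> carrier G" "commutator G x y \<in> D"
  shows "commutator G y x \<in> D"
  using assms inv_commutator by (metis subgroup.m_inv_closed)

lemma normal_commutator_in: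
  assumes "N \<lhd> G" "x \<in> N" "g \<in> carrier G"
  shows "commutator G x g \<in> N"
proof -
  interpret N: normal N G by fact
  have "x \<otimes> (g \<otimes> inv x \<otimes> inv g) \<in> N"
    using assms by (intro N.m_closed N.inv_op_closed2) auto
  then show ?thesis using assms by (simp add: commutator_def m_assoc)
qed

text \<open>The set below is the preimage of a centralizer in the quotient by \<open>D\<close>.\<close>

lemma subgroup_centralizer_mod:
  assumes D: "D \<lhd> G" and S: "S \<subseteq> carrier G"
  shows "subgroup {g \<in> carrier G. \<forall>s\<in>S. commutator G g s \<in> D} G"
proof -
  interpret D: normal D G by fact
  have one: "commutator G \<one> s \<in> D" if "s \<in> S" for s
    using that S by (simp add: commutator_def subset_iff)
  have prod: "commutator G (g \<otimes> h) s \<in> D"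
    if "g \<in> carrier G" "h \<in> carrier G" "s \<in> carrier G"
      and g: "commutator G g s \<in> D" and h: "commutator G h s \<in> D" for g h s
  proof -
    have "commutator G (g \<otimes> h) s = g \<otimes> commutator G h s \<otimes> inv g \<otimes> commutator G g s"
      using that(1-3) by (simp add: commutator_def inv_mult_group m_assoc mult_inv_cancel)
    then show ?thesis
      using that D.inv_op_closed2 by auto
  qed
  have inver: "commutator G (inv g) s \<in> D"
    if "g \<in> carrier G" "s \<in> carrier G" and g: "commutator G g s \<in> D" for g s
  proof -
    have "commutator G (inv g) s = inv g \<otimes> inv (commutator G g s) \<otimes> g"
      using that(1-2) by (simp add: commutator_def inv_mult_group m_assoc)
    then show ?thesis
      using that D.inv_op_closed1 by auto
  qed
  show ?thesis
    by (rule subgroupI) (use S one prod inver in \<open>auto simp: subset_iff\<close>)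
qed

text \<open>This is the preimage of the center of G/D. Conjugating g by h has, up to conjugation of
  the commutator, the effect of conjugating s by the inverse of h.\<close>

lemma normal_centralizer_mod:
  assumes D: "D \<lhd> G"
  shows "{g \<in> carrier G. \<forall>s\<in>carrier G. commutator G g s \<in> D} \<lhd> G"
    (is "?C \<lhd> G")
proof -
  interpret D: normal D G by fact
  have "h \<otimes> g \<otimes> inv h \<in> ?C" if h: "h \<in> carrier G" and g: "g \<in> ?C" for g h
  proof -
    have "commutator G (h \<otimes> g \<otimes> inv h) s \<in> D" if s: "s \<in> carrier G" for s
    proof -
      have "commutator G (h \<otimes> g \<otimes> inv h) s =
          h \<otimes> commutator G g (inv h \<otimes> s \<otimes> h) \<otimes> inv h"
        using h g s by (simp add: commutator_def inv_mult_group m_assoc mult_inv_cancel)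
      then show ?thesis using h g s by (auto intro!: D.inv_op_closed2)
    qed
    then show ?thesis using h g by auto
  qed
  then show ?thesis
    using subgroup_centralizer_mod[OF D, of "carrier G"] by (auto simp: normal_inv_iff)
qed

text \<open>Centralizers modulo \<open>D\<close> are subgroups, which is used twice: first for the
  left argument, then, after exchanging the arguments, for the other one.\<close>

lemma commutator_generate_in:
  assumes D: "D \<lhd> G" and S: "S \<subseteq> carrier G"
    and comm: "\<And>s t. s \<in> S \<Longrightarrow> t \<in> S \<Longrightarrow> commutator G s t \<in> D"
    and gh: "g \<in> generate G S" "h \<in> generate G S"
  shows "commutator G g h \<in> D"
proof -
  have sub: "subgroup D G" using D normal_imp_subgroup by blast
  let ?C = "\<lambda>T. {g \<in> carrier G. \<forall>s\<in>T. commutator G g s \<in> D}"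
  have "S \<subseteq> ?C S" using S comm by auto
  then have 1: "generate G S \<subseteq> ?C S"
    by (intro generate_subgroup_incl subgroup_centralizer_mod D S)
  have T: "generate G S \<subseteq> carrier G" using S generate_incl by auto
  have "S \<subseteq> ?C (generate G S)"
    using 1 S T commutator_in_sym[OF sub] by (auto simp: subset_iff)
  then have "generate G S \<subseteq> ?C (generate G S)"
    by (intro generate_subgroup_incl subgroup_centralizer_mod D T)
  then show ?thesis using gh by auto
qed

section \<open>Powers in cyclic groups and p-th powers of products\<close>

lemma nat_pow_eq_iff_cong:
  fixes i j :: nat
  assumes "x \<in> carrier G"
  shows "x [^] i = x [^] j \<longleftrightarrow> [i = j] (mod ord x)"
proof -
  have "x [^] i = x [^] j \<longleftrightarrow> x [^] int i = x [^] int j" by (simp add: int_pow_int)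
  also have "\<dots> \<longleftrightarrow> int (ord x) dvd int j - int i" by (rule int_pow_eq[OF assms])
  also have "\<dots> \<longleftrightarrow> [i = j] (mod ord x)" by (metis cong_int_iff cong_iff_dvd_diff cong_sym)
  finally show ?thesis .
qed

text \<open>A cyclic group has at most one subgroup of order p. If x has order q p, then u and b are
  powers of x^q, and u, being nontrivial, generates all of these.\<close>

lemma prime_pow_in_generate:
  assumes fin: "finite (carrier G)" and p: "Factorial_Ring.prime (p::nat)"
    and x: "x \<in> carrier G" and u: "u \<in> generate G {x}" "u \<noteq> \<one>" "u [^] p = \<one>"
    and b: "b \<in> generate G {x}" "b [^] p = \<one>"
  shows "b \<in> generate G {u}"
proof -
  let ?o = "ord x"
  have gen: "generate G {x} = {x [^] k | k. k \<in> (UNIV :: nat set)}"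
    using generate_pow_on_finite_carrier[OF fin x] .
  obtain i :: nat where i: "u = x [^] i" using u gen by auto
  obtain j :: nat where j: "b = x [^] j" using b gen by auto
  have oi: "?o dvd i * p" using u i x by (simp add: nat_pow_pow pow_eq_id)
  have oj: "?o dvd j * p" using b j x by (simp add: nat_pow_pow pow_eq_id)
  have noi: "\<not> ?o dvd i" using u i x by (simp add: pow_eq_id)
  have "p dvd ?o"
  proof (rule ccontr)
    assume "\<not> p dvd ?o"
    then have "coprime ?o p" using p by (simp add: prime_imp_coprime coprime_commute)
    then show False using oi noi coprime_dvd_mult_left_iff by blast
  qed
  then obtain q where q: "?o = q * p" by (metis dvdE mult.commute)
  have p0: "p > 0" using p prime_gt_0_nat by blast
  obtain i' where i': "i = q * i'" using oi q p0 by auto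
  obtain j' where j': "j = q * j'" using oj q p0 by auto
  have "\<not> p dvd i'" using noi q i' by auto
  then have "coprime i' p" using prime_imp_coprime[OF p] by (simp add: coprime_commute)
  \<comment> \<open>With l inverse to i' modulo p, the exponent l j' turns u = x^(q i') into b =
    x^(q j').\<close>
  then obtain l where l: "[i' * l = Suc 0] (mod p)" using cong_solve_coprime_nat by metis
  have "[i' * (l * j') = j'] (mod p)"
    using cong_scalar_right[OF l, of j'] by (simp add: mult.assoc)
  then have "q * (i' * (l * j') mod p) = q * (j' mod p)"
    by (simp only: cong_def)
  then have "[i * (l * j') = j] (mod ?o)"
    by (simp only: mult_mod_right cong_def q i' j' mult.assoc)
  then have "x [^] (i * (l * j')) = x [^] j"
    by (simp add: nat_pow_eq_iff_cong x)
  then have "u [^] (l * j') = b"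
    using x by (simp add: i j nat_pow_pow)
  then show ?thesis
    using generate_pow_on_finite_carrier[OF fin, of u] i x by auto
qed

text \<open>Here c is the commutator [b, z]. Collecting the factors z of (z b)^n on the left moves a
  b past a z exactly n (n - 1) / 2 times, each time at the cost of one factor c.\<close>

lemma pow_mult_commutator:
  assumes z: "z \<in> carrier G" and b: "b \<in> carrier G" and c: "c \<in> carrier G"
    and bz: "b \<otimes> z = c \<otimes> (z \<otimes> b)" and cz: "c \<otimes> z = z \<otimes> c" and cb: "c \<otimes> b = b \<otimes> c"
  shows "(z \<otimes> b) [^] (n::nat) = c [^] (n * (n - 1) div 2) \<otimes> (z [^] n \<otimes> b [^] n)"
proof (induction n)
  case 0
  then show ?case by simp
next
  case (Suc n)
  have bnz: "b [^] (m::nat) \<otimes> z = c [^] m \<otimes> (z \<otimes> b [^] m)" for m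
  proof (induction m)
    case (Suc m)
    have "b [^] Suc m \<otimes> z = b [^] m \<otimes> (b \<otimes> z)" using z b by (simp add: m_assoc)
    also have "\<dots> = (b [^] m \<otimes> c) \<otimes> (z \<otimes> b)" using z b c by (simp add: bz m_assoc)
    also have "b [^] m \<otimes> c = c \<otimes> b [^] m" using group_commutes_pow[OF cb[symmetric] b c] .
    also have "c \<otimes> b [^] m \<otimes> (z \<otimes> b) = c \<otimes> (b [^] m \<otimes> z) \<otimes> b" using z b c by (simp add: m_assoc)
    also have "\<dots> = (c \<otimes> c [^] m) \<otimes> (z \<otimes> b [^] Suc m)" using z b c by (simp add: Suc m_assoc)
    finally show ?case using nat_pow_Suc2[OF c, of m] by simp
  qed (use z in simp)
  have zc: "z [^] (n::nat) \<otimes> c [^] (m::nat) = c [^] m \<otimes> z [^] n" for m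
    using group_commutes_pow[OF group_commutes_pow[OF cz c z, symmetric]] z c by simp
  have "(z \<otimes> b) [^] Suc n = c [^] (n * (n - 1) div 2) \<otimes> (z [^] n \<otimes> (b [^] n \<otimes> z) \<otimes> b)"
    using z b c by (simp add: Suc m_assoc)
  also have "z [^] n \<otimes> (b [^] n \<otimes> z) \<otimes> b = (z [^] n \<otimes> c [^] n) \<otimes> z \<otimes> b [^] n \<otimes> b"
    using z b c by (simp add: bnz m_assoc)
  also have "\<dots> = c [^] n \<otimes> (z [^] Suc n \<otimes> b [^] Suc n)"
    using z b c by (simp add: zc m_assoc)
  also have "c [^] (n * (n - 1) div 2) \<otimes> (c [^] n \<otimes> (z [^] Suc n \<otimes> b [^] Suc n)) =
     c [^] (n * (n - 1) div 2 + n) \<otimes> (z [^] Suc n \<otimes> b [^] Suc n)"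
    using z b c by (simp add: m_assoc flip: nat_pow_mult)
  also have "n * (n - 1) div 2 + n = Suc n * (Suc n - 1) div 2"
    by (cases n) (auto simp: algebra_simps)
  finally show ?case .
qed

lemma subgroup_nat_pow_closed:
  "subgroup H G \<Longrightarrow> x \<in> H \<Longrightarrow> x [^] (m::nat) \<in> H"
  using subgroup_int_pow_closed by (metis int_pow_int)

text \<open>An odd \<open>p\<close> divides p (p - 1) / 2, so the correcting power of c in
  \<open>pow_mult_commutator\<close> is trivial.\<close>

lemma odd_pow_mult_commutator:
  fixes p :: nat
  assumes "odd p" and "z \<in> carrier G" "b \<in> carrier G"
    and c: "commutator G b z = c" "c [^] p = \<one>" "commutator G c z = \<one>" "commutator G c b = \<one>"
  shows "(z \<otimes> b) [^] p = z [^] p \<otimes> b [^] p"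
proof -
  have cc: "c \<in> carrier G" using assms by auto
  obtain m where m: "p = 2 * m + 1" using \<open>odd p\<close> oddE by blast
  have "p * (p - 1) div 2 = p * m" using m by simp
  then have "c [^] (p * (p - 1) div 2) = \<one>" using cc c(2) by (simp flip: nat_pow_pow)
  then show ?thesis
    using pow_mult_commutator[of z b c p] assms cc commutator_mult[of b z]
    by (auto simp: commutator_eq_one_iff)
qed

section \<open>Homomorphisms and quotient maps\<close>

lemma normal_vimage:
  assumes "group_hom G H h" "N \<lhd> H"
  shows "{g \<in> carrier G. h g \<in> N} \<lhd> G"
proof -
  interpret h: group_hom G H h by fact
  interpret N: normal N H by fact
  have "subgroup {g \<in> carrier G. h g \<in> N} G"
    by (rule subgroupI) auto
  then show ?thesis
    by (auto simp: normal_inv_iff intro!: N.inv_op_closed2)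
qed

lemma hom_commutator:
  assumes "group_hom G H h" "x \<in> carrier G" "y \<in> carrier G"
  shows "h (commutator G x y) = commutator H (h x) (h y)"
proof -
  interpret h: group_hom G H h by fact
  show ?thesis using assms by (simp add: commutator_def)
qed

end

context normal
begin

lemma group_hom_r_coset: "group_hom G (G Mod H) ((#>) H)"
  by (intro group_hom.intro group_hom_axioms.intro r_coset_hom_Mod factorgroup_is_group is_group)

lemma r_coset_eq_iff: "x \<in> carrier G \<Longrightarrow> H #> x = H \<longleftrightarrow> x \<in> H"
  using subgroup_axioms coset_join1 coset_join2 by (metis subset rcos_self)

end

section \<open>Central elements of \<open>p\<close>-groups\<close>

locale p_group = group G for G (structure) +
  fixes p n :: nat
  assumes prime: "Factorial_Ring.prime p" and order_eq: "order G = p ^ n"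
begin

text \<open>An infinite carrier would have order 0, which is not a power of
  \<open>p\<close>.\<close>

lemma finite_carrier [simp]: "finite (carrier G)"
  using order_gt_0_iff_finite order_eq prime prime_gt_0_nat by simp

lemma card_subgroup:
  assumes "subgroup H G"
  obtains k where "card H = p ^ k"
proof -
  have "card H dvd p ^ n"
    using lagrange[OF assms] order_eq by (metis dvd_triv_right)
  then show ?thesis using that divides_primepow_nat[OF prime] by auto
qed

lemma p_group_Mod:
  assumes "N \<lhd> G"
  shows "\<exists>m. p_group (G Mod N) p m"
proof -
  interpret N: normal N G by fact
  have "card (rcosets N) dvd p ^ n"
    using lagrange[OF N.subgroup_axioms] order_eq by (metis dvd_triv_left)
  then obtain m where "card (rcosets N) = p ^ m" using divides_primepow_nat[OF prime] by auto
  then show ?thesis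
    using prime N.factorgroup_is_group
    by (intro exI[of _ m]) (simp add: p_group_def p_group_axioms_def order_def FactGroup_def)
qed

text \<open>The conjugacy classes of noncentral elements have size divisible by \<open>p\<close>.\<close>

lemma normal_Int_center_nontrivial:
  assumes N: "N \<lhd> G" and "N \<noteq> {\<one>}"
  shows "\<exists>z\<in>N. z \<noteq> \<one> \<and> (\<forall>g\<in>carrier G. commutator G z g = \<one>)"
proof (rule ccontr)
  assume neg: "\<not> ?thesis"
  interpret N: normal N G by fact
  define \<phi> where "\<phi> = (\<lambda>g. \<lambda>h \<in> carrier G. g \<otimes> h \<otimes> inv g)"
  interpret A: group_action G "carrier G" \<phi>
    unfolding \<phi>_def by (rule action_by_conjugation)
  have finN: "finite N" using finite_subset[OF N.subset] by simp
  have orb: "orbit G \<phi> x = {g \<otimes> x \<otimes> inv g | g. g \<in> carrier G}" if "x \<in> carrier G" for x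
    using that by (auto simp: orbit_def \<phi>_def)
  have dvd: "p dvd card (orbit G \<phi> x)" if x: "x \<in> N" "x \<noteq> \<one>" for x
  proof -
    have xG: "x \<in> carrier G" using x N.subset by auto
    have "card (orbit G \<phi> x) dvd p ^ n"
      using A.orbit_stabilizer_theorem[OF xG] order_eq by (metis dvd_triv_left)
    then obtain k where k: "card (orbit G \<phi> x) = p ^ k" using divides_primepow_nat[OF prime] by auto
    have "k \<noteq> 0"
    proof
      assume "k = 0"
      then obtain y where y: "orbit G \<phi> x = {y}" using k by (auto simp: card_1_singleton_iff)
      have "x \<in> orbit G \<phi> x" using A.orbit_refl xG by blast
      then have "g \<otimes> x \<otimes> inv g = x" if "g \<in> carrier G" for g
        using y orb[OF xG] that by (metis (mono_tags, lifting) mem_Collect_eq singletonD)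
      then have "commutator G x g = \<one>" if "g \<in> carrier G" for g
        using that xG by (metis commutator_eq_one_iff inv_solve_right' m_closed)
      then show False using neg x by blast
    qed
    then show ?thesis using k by simp
  qed
  \<comment> \<open>No element of N - {1} is central by assumption, so p divides the size of its
    conjugacy class. These classes partition N - {1}; thus p divides card N - 1, but it also divides
    card N.\<close>
  define C where "C = orbit G \<phi> ` (N - {\<one>})"
  have sub: "orbit G \<phi> x \<subseteq> N - {\<one>}" if x: "x \<in> N" "x \<noteq> \<one>" for x
  proof -
    have xG: "x \<in> carrier G" using x N.subset by auto
    have "g \<otimes> x \<otimes> inv g \<noteq> \<one>" if "g \<in> carrier G" for g
      using that xG x(2) by (metis inv_solve_right' l_cancel_one m_closed one_closed r_one l_one)
    then show ?thesis using orb[OF xG] x(1) N.inv_op_closed2 by auto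
  qed
  have U: "\<Union>C = N - {\<one>}"
    using sub A.orbit_refl N.subset unfolding C_def by blast
  have "p dvd card (\<Union>C)"
  proof (rule dvd_partition)
    show "finite (\<Union>C)" using U finN by simp
    show "\<forall>c\<in>C. p dvd card c" using dvd by (auto simp: C_def)
    have "C \<subseteq> orbits G (carrier G) \<phi>" using N.subset by (auto simp: C_def orbits_def)
    then show "\<forall>c1\<in>C. \<forall>c2\<in>C. c1 \<noteq> c2 \<longrightarrow> c1 \<inter> c2 = {}"
      using A.disjoint_union by (meson subset_iff)
  qed
  then have 1: "p dvd card N - 1" using U finN N.one_closed by simp
  obtain k where k: "card N = p ^ k" using card_subgroup[OF N.subgroup_axioms] by blast
  have "k \<noteq> 0"
    using \<open>N \<noteq> {\<one>}\<close> N.one_closed k by (metis card_1_singletonE power_0 singletonD)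
  then have "p dvd card N" using k by simp
  moreover have "card N \<ge> 1" using N.one_closed finN by (metis card_0_eq empty_iff less_one not_le)
  ultimately have "p dvd 1" using 1 by (metis dvd_diffD1)
  then show False using prime by simp
qed

text \<open>A central element of order p^(l+1), raised to the power p^l, has order p and stays
  central.\<close>

lemma normal_central_prime_element:
  assumes N: "N \<lhd> G" and "N \<noteq> {\<one>}"
  obtains z where "z \<in> N" "z \<noteq> \<one>" "z [^] p = \<one>" "\<And>g. g \<in> carrier G \<Longrightarrow> commutator G z g = \<one>"
proof -
  interpret N: normal N G by fact
  obtain y where y: "y \<in> N" "y \<noteq> \<one>" "\<And>g. g \<in> carrier G \<Longrightarrow> commutator G y g = \<one>"
    using normal_Int_center_nontrivial[OF assms] by blast
  have yG: "y \<in> carrier G" using y N.subset by auto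
  obtain k where k: "ord y = p ^ k"
    using ord_dvd_group_order[OF yG] order_eq divides_primepow_nat[OF prime] by auto
  have "k \<noteq> 0" using y yG k ord_eq_1 by (metis power_0)
  then obtain l where l: "k = Suc l" by (cases k) auto
  let ?z = "y [^] (p ^ l)"
  have "?z \<in> N" using y(1) using subgroup_nat_pow_closed[OF N.subgroup_axioms] by blast
  moreover have "?z \<noteq> \<one>"
  proof
    assume "?z = \<one>"
    then have "p ^ Suc l dvd p ^ l" using pow_eq_id[OF yG] k l by simp
    then show False using prime by (metis Suc_n_not_le_n dvd_power_iff_le prime_ge_2_nat)
  qed
  moreover have "?z [^] p = \<one>"
    using yG k l by (simp add: nat_pow_pow pow_eq_id mult.commute)
  moreover have "commutator G ?z g = \<one>" if g: "g \<in> carrier G" for g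
  proof -
    have "y [^] (m::nat) \<otimes> g = g \<otimes> y [^] m" for m
      using y(3)[OF g] yG g group_commutes_pow commutator_eq_one_iff by metis
    then show ?thesis using yG g by (simp add: commutator_eq_one_iff)
  qed
  ultimately show ?thesis using that by blast
qed

text \<open>The central element of order p is found in the image of B in G/A and lifted to
  B.\<close>

lemma normal_chain_step:
  assumes A: "A \<lhd> G" and B: "B \<lhd> G" and AB: "A \<subset> B"
  obtains z where "z \<in> B" "z \<notin> A" "z [^] p \<in> A" "\<And>g. g \<in> carrier G \<Longrightarrow> commutator G z g \<in> A"
proof -
  interpret A: normal A G by fact
  interpret B: normal B G by fact
  interpret h: group_hom G "G Mod A" "(#>) A" by (rule A.group_hom_r_coset)
  obtain m where "p_group (G Mod A) p m" using p_group_Mod[OF A] by blast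
  then interpret Q: p_group "G Mod A" p m .
  have "(#>) A ` B \<lhd> G Mod A"
    using B.surj_hom_normal_subgroup[OF A.group_hom_r_coset] by (simp add: carrier_FactGroup)
  moreover have "(#>) A ` B \<noteq> {\<one>\<^bsub>G Mod A\<^esub>}"
  proof -
    obtain b where "b \<in> B" "b \<notin> A" using AB by blast
    then have "A #> b \<noteq> A" using A.r_coset_eq_iff B.subset by blast
    then show ?thesis using \<open>b \<in> B\<close> by auto
  qed
  ultimately obtain Z where Z: "Z \<in> (#>) A ` B" "Z \<noteq> \<one>\<^bsub>G Mod A\<^esub>" "Z [^]\<^bsub>G Mod A\<^esub> p = \<one>\<^bsub>G Mod A\<^esub>"
      "\<And>g. g \<in> carrier (G Mod A) \<Longrightarrow> commutator (G Mod A) Z g = \<one>\<^bsub>G Mod A\<^esub>"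
    by (rule Q.normal_central_prime_element) blast
  obtain z where z: "z \<in> B" "Z = A #> z" using Z by auto
  have zG: "z \<in> carrier G" using z B.subset by auto
  show ?thesis
  proof (rule that[OF z(1)])
    show "z \<notin> A" using Z(2) z(2) zG A.r_coset_eq_iff by auto
    show "z [^] p \<in> A" using Z(3) zG z(2) A.r_coset_eq_iff
      by (metis h.hom_nat_pow nat_pow_closed one_FactGroup)
    show "commutator G z g \<in> A" if "g \<in> carrier G" for g
      using Z(4)[of "A #> g"] that zG z(2) A.r_coset_eq_iff hom_commutator[OF A.group_hom_r_coset zG that]
      by (metis h.hom_closed commutator_closed one_FactGroup)
  qed
qed

end

section \<open>A central step outside a given cyclic subgroup\<close>

context group
begin

lemma mem_generate_singleton_iff:
  "finite (carrier G) \<Longrightarrow> a \<in> carrier G \<Longrightarrow> x \<in> generate G {a} \<longleftrightarrow> (\<exists>k::nat. x = a [^] k)"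
  using generate_pow_on_finite_carrier[of a] by auto

lemma subgroup_generate_singleton: "a \<in> carrier G \<Longrightarrow> subgroup (generate G {a}) G"
  by (simp add: generate_is_subgroup)

text \<open>All elements h of the generated subgroup are central modulo \<open>A\<close>, so the
  conjugate of h by g, which is [g, h] h, stays in it.\<close>

lemma normal_generate_insert:
  assumes A: "A \<lhd> G" and z: "z \<in> carrier G"
    and zc: "\<And>g. g \<in> carrier G \<Longrightarrow> commutator G z g \<in> A"
  shows "generate G (insert z A) \<lhd> G"
proof -
  interpret A: normal A G by fact
  let ?H = "generate G (insert z A)"
  let ?C = "{g \<in> carrier G. \<forall>s\<in>carrier G. commutator G g s \<in> A}"
  have zA: "insert z A \<subseteq> carrier G" using z A.subset by auto
  then have H: "subgroup ?H G" by (rule generate_is_subgroup)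
  have "insert z A \<subseteq> ?C" using zA zc normal_commutator_in[OF A] by auto
  then have HC: "?H \<subseteq> ?C"
    by (intro generate_subgroup_incl normal_imp_subgroup normal_centralizer_mod A)
  have "g \<otimes> h \<otimes> inv g \<in> ?H" if h: "h \<in> ?H" and g: "g \<in> carrier G" for g h
  proof -
    have hG: "h \<in> carrier G" using h HC by auto
    have "commutator G g h \<in> A"
      using commutator_in_sym[OF A.subgroup_axioms hG g] h g HC by blast
    then have "commutator G g h \<otimes> h \<in> ?H"
      using h by (auto intro: generate.eng generate.incl)
    then show ?thesis using hG g by (simp add: commutator_def m_assoc)
  qed
  then show ?thesis using H by (simp add: normal_inv_iff)
qed

end

context p_group
begin

text \<open>The nontrivial normal subgroup M contains an element u of order p central in G. As M is
  cyclic, u generates all solutions of m^p = 1 in M, so these are central as well.\<close>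

lemma cyclic_omega_central:
  assumes M: "M \<lhd> G" and Mgen: "M = generate G {a}" and a: "a \<in> carrier G" and "a \<noteq> \<one>"
  defines "W \<equiv> {m \<in> M. m [^] p = \<one>}"
  obtains u where "W = generate G {u}" "u \<in> W" "u \<noteq> \<one>" "W \<lhd> G"
    "\<And>w g. w \<in> W \<Longrightarrow> g \<in> carrier G \<Longrightarrow> commutator G w g = \<one>"
proof -
  interpret M: normal M G by fact
  have "a \<in> M" using Mgen by (simp add: generate.incl)
  obtain u where u: "u \<in> M" "u \<noteq> \<one>" "u [^] p = \<one>"
      and uc: "\<And>g. g \<in> carrier G \<Longrightarrow> commutator G u g = \<one>"
    using normal_central_prime_element[OF M] \<open>a \<in> M\<close> \<open>a \<noteq> \<one>\<close> by blast
  have uG: "u \<in> carrier G" using u M.subset by auto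
  have "W \<subseteq> generate G {u}"
    using prime_pow_in_generate[OF finite_carrier prime a] u by (auto simp: W_def Mgen)
  moreover have "generate G {u} \<subseteq> W"
  proof
    fix w assume w: "w \<in> generate G {u}"
    then obtain k :: nat where k: "w = u [^] k" using uG by (auto simp: mem_generate_singleton_iff)
    have "w [^] p = (u [^] p) [^] k" using k uG by (simp add: nat_pow_pow mult.commute)
    then show "w \<in> W" using u k subgroup_nat_pow_closed[OF M.subgroup_axioms]
      by (simp add: W_def)
  qed
  ultimately have W: "W = generate G {u}" by blast
  have comm: "commutator G w g = \<one>" if w: "w \<in> W" and g: "g \<in> carrier G" for w g
  proof -
    obtain k :: nat where "w = u [^] k" using w uG by (auto simp: W mem_generate_singleton_iff)
    then show ?thesis
      using uc[OF g] uG g group_commutes_pow by (simp add: commutator_eq_one_iff)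
  qed
  have "g \<otimes> w \<otimes> inv g = w" if w: "w \<in> W" and g: "g \<in> carrier G" for w g
  proof -
    have wG: "w \<in> carrier G" using w M.subset by (auto simp: W_def)
    then have "w \<otimes> g = g \<otimes> w" using comm[OF w g] g by (simp add: commutator_eq_one_iff)
    then show ?thesis using wG g by (metis inv_solve_right' m_closed)
  qed
  then have "W \<lhd> G"
    using subgroup_generate_singleton[OF uG] by (auto simp: normal_inv_iff W)
  then show ?thesis using that W u comm by (auto simp: W_def)
qed

lemma minimal_noncyclic_normal:
  assumes noncyc: "\<And>y. y \<in> carrier G \<Longrightarrow> generate G {y} \<noteq> carrier G"
  obtains N a z where "N \<lhd> G" "generate G {a} \<lhd> G" "a \<in> carrier G" "z \<in> carrier G"
    "N = generate G (insert z (generate G {a}))"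
    "z [^] p \<in> generate G {a}" "\<And>y. y \<in> N \<Longrightarrow> generate G {y} \<noteq> N"
proof -
  let ?P = "\<lambda>N. N \<lhd> G \<and> (\<forall>y\<in>N. generate G {y} \<noteq> N)"
  have "?P (carrier G)" using noncyc normal_self by auto
  then obtain N where N: "?P N" and Nmin: "\<And>N'. ?P N' \<Longrightarrow> card N \<le> card N'"
    using exists_least_iff[of "\<lambda>k. \<exists>N. ?P N \<and> card N = k"] by (metis not_le)
  have Nn: "N \<lhd> G" using N by blast
  interpret N: normal N G by (rule Nn)
  have finN: "finite N" using finite_subset[OF N.subset] by simp
  let ?Q = "\<lambda>M. M \<lhd> G \<and> M \<subset> N"
  \<comment> \<open>The trivial group is cyclic, so \<open>N\<close> is nontrivial and has a proper
    normal subgroup to start from.\<close>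
  have "generate G {\<one>} = {\<one>}" by (auto simp: generate_pow)
  then have "N \<noteq> {\<one>}" using N by blast
  then have ne: "{M. ?Q M} \<noteq> {}" using N.one_closed one_is_normal by blast
  have "{M. ?Q M} \<subseteq> Pow N" by blast
  then have "finite {M. ?Q M}" using finN by (meson finite_Pow_iff finite_subset)
  from finite_has_maximal[OF this ne]
  obtain M where M: "?Q M" and Mmax: "\<And>M'. ?Q M' \<Longrightarrow> M \<subseteq> M' \<Longrightarrow> M = M'"
    by auto
  have Mn: "M \<lhd> G" using M by blast
  interpret M: normal M G by (rule Mn)
  have "card M < card N" using M finN psubset_card_mono by blast
  \<comment> \<open>A noncyclic \<open>M\<close> would contradict the minimality of
    \<open>N\<close>.\<close>
  then obtain a where a: "a \<in> M" "generate G {a} = M" using Nmin[of M] M by force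
  obtain z where z: "z \<in> N" "z \<notin> M" "z [^] p \<in> M" "\<And>g. g \<in> carrier G \<Longrightarrow> commutator G z g \<in> M"
    using normal_chain_step[OF Mn Nn] M by blast
  have zG: "z \<in> carrier G" using z N.subset by auto
  \<comment> \<open>A normal subgroup of G strictly above \<open>M\<close> and inside
    \<open>N\<close> must be \<open>N\<close> by maximality of \<open>M\<close>.\<close>
  let ?A = "generate G (insert z M)"
  have "?A \<lhd> G" using normal_generate_insert[OF Mn zG z(4)] .
  moreover have "?A \<subseteq> N" using z M N.subgroup_axioms by (intro generate_subgroup_incl) auto
  moreover have "M \<subset> ?A" using z(2) by (auto intro: generate.incl)
  ultimately have "N = ?A" using Mmax[of ?A] by blast
  then show ?thesis using that[of N a z] N Mn a zG M.subset z by auto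
qed

text \<open>\<open>D\<close> is the subgroup \<open>W\<close> of order p in the cyclic group
  \<open>M\<close>, and \<open>E\<close> is the preimage \<open>?C\<close> of the center of G/W. The
  element e of order p found in \<open>?C\<close> outside \<open>W\<close> keeps \<open>?C\<close>
  from lying in a cyclic group.\<close>

lemma exists_central_step_outside_cyclic:
  assumes "odd p" and noncyc: "\<And>y. y \<in> carrier G \<Longrightarrow> generate G {y} \<noteq> carrier G"
    and x: "x \<in> carrier G"
  obtains D E where "D \<lhd> G" "E \<lhd> G" "D \<subseteq> E" "\<not> E \<subseteq> generate G {x}"
    "\<And>d g. d \<in> D \<Longrightarrow> g \<in> carrier G \<Longrightarrow> commutator G d g = \<one>"
    "\<And>e g. e \<in> E \<Longrightarrow> g \<in> carrier G \<Longrightarrow> commutator G e g \<in> D"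
proof -
  obtain N a z where N: "N \<lhd> G" and Mn: "generate G {a} \<lhd> G" and a: "a \<in> carrier G"
    and z: "z \<in> carrier G" and Nz: "N = generate G (insert z (generate G {a}))"
    and zp: "z [^] p \<in> generate G {a}" and Nnc: "\<And>y. y \<in> N \<Longrightarrow> generate G {y} \<noteq> N"
    using minimal_noncyclic_normal[OF noncyc] by blast
  define M where "M = generate G {a}"
  have M: "M \<lhd> G" using Mn by (simp add: M_def)
  interpret N: normal N G by (rule N)
  interpret M: normal M G by (rule M)
  have memM: "m \<in> M \<longleftrightarrow> (\<exists>k::nat. m = a [^] k)" for m
    using a by (simp add: M_def mem_generate_singleton_iff)
  have aM: "a \<in> M" by (simp add: M_def generate.incl)
  have NzM: "N = generate G (insert z M)" by (simp add: Nz M_def)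
  have zN: "z \<in> N" and MN: "M \<subseteq> N" by (auto simp: NzM intro: generate.incl)
  \<comment> \<open>As N is noncyclic, a is not a power of z; this will force p to divide j.\<close>
  have Neq: "N = generate G {z}" if "a \<in> generate G {z}"
  proof
    have "M \<subseteq> generate G {z}"
      unfolding M_def using that z by (intro generate_subgroup_incl subgroup_generate_singleton) auto
    then show "N \<subseteq> generate G {z}"
      unfolding NzM using z
      by (intro generate_subgroup_incl subgroup_generate_singleton) (auto intro: generate.incl)
    show "generate G {z} \<subseteq> N"
      using zN by (intro generate_subgroup_incl N.subgroup_axioms) auto
  qed
  have anz: "a \<notin> generate G {z}" using Neq Nnc zN by blast
  then have "a \<noteq> \<one>" by (metis generate.one)
  define W where "W = {m \<in> M. m [^] p = \<one>}"
  obtain u where Wu: "W = generate G {u}" and u: "u \<in> W" "u \<noteq> \<one>" and Wn: "W \<lhd> G"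
    and Wc: "\<And>w g. w \<in> W \<Longrightarrow> g \<in> carrier G \<Longrightarrow> commutator G w g = \<one>"
    using cyclic_omega_central[OF M M_def a \<open>a \<noteq> \<one>\<close>] unfolding W_def by blast
  interpret W: normal W G by (rule Wn)
  obtain k where ordk: "ord a = p ^ k"
    using ord_dvd_group_order[OF a] order_eq divides_primepow_nat[OF prime] by auto
  have "k \<noteq> 0" using \<open>a \<noteq> \<one>\<close> a ordk ord_eq_1 by (metis power_0)
  have apow: "a [^] (i::nat) = a [^] (j::nat) \<longleftrightarrow> [i = j] (mod p ^ k)" for i j
    using nat_pow_eq_iff_cong[OF a] by (simp add: ordk)
  obtain r :: nat where r: "z \<otimes> a \<otimes> inv z = a [^] r"
    using M.inv_op_closed2[OF z aM] memM by blast
  have conj: "z [^] (i::nat) \<otimes> a [^] (j::nat) \<otimes> inv (z [^] i) = a [^] (j * r ^ i)" for i j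
  proof (induction i arbitrary: j)
    case 0
    then show ?case using a by simp
  next
    case (Suc i)
    have conj1: "z \<otimes> a [^] j \<otimes> inv z = a [^] (j * r)" for j
    proof (induction j)
      case (Suc j)
      have "z \<otimes> a [^] Suc j \<otimes> inv z = (z \<otimes> a [^] j \<otimes> inv z) \<otimes> (z \<otimes> a \<otimes> inv z)"
        using z a by (simp add: m_assoc mult_inv_cancel)
      also have "\<dots> = a [^] (Suc j * r)" using a by (simp add: Suc r nat_pow_mult add.commute)
      finally show ?case .
    qed (use z in simp)
    have "z [^] Suc i \<otimes> a [^] j \<otimes> inv (z [^] Suc i) =
        z [^] i \<otimes> (z \<otimes> a [^] j \<otimes> inv z) \<otimes> inv (z [^] i)"
      using z a by (simp add: m_assoc inv_mult_group)
    also have "\<dots> = a [^] (j * r ^ Suc i)" by (simp add: conj1 Suc mult.assoc)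
    finally show ?case .
  qed
  obtain j :: nat where j: "z [^] p = a [^] j" using zp memM by (auto simp: M_def)
  \<comment> \<open>Conjugation by z^p is the power map with exponent r^p on \<open>M\<close>, but
    z^p lies in the abelian group \<open>M\<close> and fixes a.\<close>
  have "a [^] (r ^ p) = z [^] p \<otimes> a \<otimes> inv (z [^] p)"
    using conj[of p 1] a by simp
  also have "\<dots> = a" using group_commutes_pow[of a a j] a by (simp add: j m_assoc)
  finally have "[r ^ p = 1] (mod p ^ k)" using apow[of "r ^ p" 1] a by simp
  then have rk: "[p * r = p] (mod p ^ k)"
    using odd_prime_power_cong_mult[OF prime \<open>odd p\<close>] \<open>k \<noteq> 0\<close> by simp
  \<comment> \<open>For m = a^i the commutator is a^(i (r - 1)), whose p-th power is trivial by
    \<open>rk\<close>. Over the naturals the exponent i (r - 1) is represented by l with l + i = i r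
    modulo p^k.\<close>
  have zm: "commutator G z m \<in> W" if m: "m \<in> M" for m
  proof -
    obtain i :: nat where i: "m = a [^] i" using m memM by auto
    let ?c = "commutator G z m"
    have cM: "?c \<in> M"
      using commutator_in_sym[OF M.subgroup_axioms _ z normal_commutator_in[OF M m z]] m M.subset by blast
    have cG: "?c \<in> carrier G" using cM M.subset by blast
    have "?c \<otimes> m = z \<otimes> m \<otimes> inv z" using i z a by (simp add: commutator_def m_assoc)
    also have "\<dots> = a [^] (i * r)" using conj[of 1 i] z by (simp add: i)
    finally have *: "?c \<otimes> m = a [^] (i * r)" .
    obtain l :: nat where l: "?c = a [^] l" using cM memM by auto
    have "[l + i = i * r] (mod p ^ k)" using *[unfolded l, unfolded i] apow a by (simp add: nat_pow_mult)
    then have "[p * (l + i) = i * (p * r)] (mod p ^ k)"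
      by (metis cong_scalar_left mult.left_commute)
    also have "[i * (p * r) = i * p] (mod p ^ k)" using rk cong_scalar_left by blast
    finally have "[p * l + p * i = 0 + p * i] (mod p ^ k)"
      by (simp add: algebra_simps)
    then have "[l * p = 0] (mod p ^ k)" by (simp only: cong_add_rcancel_nat mult.commute)
    then have "?c [^] p = \<one>" using apow[of "l * p" 0] a l by (simp add: nat_pow_pow)
    then show ?thesis using cM by (simp add: W_def)
  qed
  \<comment> \<open>Generators suffice: M is abelian, and z commutes with M modulo W.\<close>
  have NW: "commutator G g h \<in> W" if "g \<in> N" "h \<in> N" for g h
  proof (rule commutator_generate_in[OF Wn])
    show "insert z M \<subseteq> carrier G" using z M.subset by auto
    show "g \<in> generate G (insert z M)" "h \<in> generate G (insert z M)" using that NzM by auto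
    fix s t assume st: "s \<in> insert z M" "t \<in> insert z M"
    have MM: "commutator G s t = \<one>" if st: "s \<in> M" "t \<in> M" for s t
    proof -
      obtain i j :: nat where "s = a [^] i" "t = a [^] j" using st memM by meson
      then show ?thesis using a by (simp add: commutator_eq_one_iff nat_pow_comm)
    qed
    have mz: "commutator G m z \<in> W" if "m \<in> M" for m
      using commutator_in_sym[OF W.subgroup_axioms z _ zm] that M.subset by blast
    consider "s = z" "t = z" | "s = z" "t \<in> M" | "s \<in> M" "t = z" | "s \<in> M" "t \<in> M"
      using st by blast
    then show "commutator G s t \<in> W"
      by cases (simp_all add: z zm mz MM W.one_closed)
  qed
  \<comment> \<open>Commutators of elements of N lie in W, which is central with trivial p-th
    powers.\<close>
  have powmult: "(g \<otimes> h) [^] p = g [^] p \<otimes> h [^] p" if "g \<in> N" "h \<in> N" for g h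
  proof (rule odd_pow_mult_commutator[OF \<open>odd p\<close>])
    show gh: "g \<in> carrier G" "h \<in> carrier G" using that N.subset by auto
    have "commutator G h g \<in> W" using NW that by blast
    then show "commutator G h g [^] p = \<one>" "commutator G (commutator G h g) g = \<one>"
         "commutator G (commutator G h g) h = \<one>"
      using Wc gh by (auto simp: W_def)
  qed auto
  \<comment> \<open>The kernel of the p-th power endomorphism of N.\<close>
  define F where "F = {g \<in> N. g [^] p = \<one>}"
  have "subgroup F G"
  proof (rule subgroupI)
    show "F \<subseteq> carrier G" using N.subset by (auto simp: F_def)
    show "F \<noteq> {}" using N.one_closed nat_pow_one[of p] unfolding F_def by blast
    show "inv f \<in> F" if "f \<in> F" for f using that N.subset by (auto simp: F_def nat_pow_inv)
    show "f \<otimes> g \<in> F" if "f \<in> F" "g \<in> F" for f g using that by (auto simp: F_def powmult)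
  qed
  moreover have "g \<otimes> f \<otimes> inv g \<in> F" if f: "f \<in> F" and g: "g \<in> carrier G" for f g
  proof -
    have fG: "f \<in> carrier G" using f N.subset by (auto simp: F_def)
    have "(g \<otimes> f \<otimes> inv g) [^] (i::nat) = g \<otimes> f [^] i \<otimes> inv g" for i
      by (induction i) (use fG g in \<open>simp_all add: m_assoc mult_inv_cancel\<close>)
    then show ?thesis using f fG g N.inv_op_closed2 by (simp add: F_def)
  qed
  ultimately have Fn: "F \<lhd> G" by (auto simp: normal_inv_iff)
  \<comment> \<open>Otherwise z^p = a^j would generate M, and a would be a power of z.\<close>
  have "p dvd j"
  proof (rule ccontr)
    assume "\<not> p dvd j"
    then have "coprime j (p ^ k)" using prime_imp_coprime[OF prime] by (simp add: coprime_commute)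
    then obtain l where "[j * l = Suc 0] (mod p ^ k)" using cong_solve_coprime_nat by metis
    then have "(z [^] p) [^] l = a" using apow[of "j * l" 1] a by (simp add: j nat_pow_pow)
    then have "a = z [^] (p * l)" using z by (simp add: nat_pow_pow)
    then show False using anz z by (auto simp: mem_generate_singleton_iff)
  qed
  then obtain s where s: "j = p * s" by auto
  \<comment> \<open>Both z and a^s have the p-th power a^(p s), so their quotient w lies in
    F.\<close>
  define w where "w = z \<otimes> inv (a [^] s)"
  have asM: "inv (a [^] s) \<in> M" using memM M.m_inv_closed by blast
  then have asN: "inv (a [^] s) \<in> N" using MN by auto
  have "w [^] p = \<one>"
    using powmult[OF zN asN] a by (simp add: w_def nat_pow_inv nat_pow_pow j s mult.commute)
  then have wF: "w \<in> F" using zN asN by (simp add: F_def w_def)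
  \<comment> \<open>Otherwise z would lie in M, and N would be the cyclic group M.\<close>
  have "w \<notin> M"
  proof
    assume "w \<in> M"
    then have "w \<otimes> a [^] s \<in> M" using memM by blast
    then have "z \<in> M" using z a by (simp add: w_def m_assoc)
    then have "N = M" unfolding NzM using generateI[OF M.subgroup_axioms]
      by (simp add: insert_absorb generate_subgroup_incl)
    then show False using Nnc[of a] aM M_def by simp
  qed
  then have "W \<subset> F" using wF MN by (auto simp: W_def F_def)
  then obtain e where e: "e \<in> F" "e \<notin> W" "\<And>g. g \<in> carrier G \<Longrightarrow> commutator G e g \<in> W"
    using normal_chain_step[OF Wn Fn] by metis
  have eG: "e \<in> carrier G" using e N.subset by (auto simp: F_def)
  let ?C = "{g \<in> carrier G. \<forall>s\<in>carrier G. commutator G g s \<in> W}"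
  show ?thesis
  proof (rule that)
    show "W \<lhd> G" by (rule Wn)
    show "?C \<lhd> G" by (rule normal_centralizer_mod[OF Wn])
    show "W \<subseteq> ?C" using Wc W.subset W.one_closed by auto
    then have WC: "W \<subseteq> ?C" .
    show "\<not> ?C \<subseteq> generate G {x}"
    proof
      assume sub: "?C \<subseteq> generate G {x}"
      \<comment> \<open>Both u and e would solve g^p = 1 in one cyclic group, which puts e into the
        group W generated by u.\<close>
      have "u \<in> generate G {x}" using sub WC u by blast
      moreover have "e \<in> generate G {x}" using sub e eG by blast
      moreover have "u [^] p = \<one>" "e [^] p = \<one>" using u e by (simp_all add: W_def F_def)
      ultimately have "e \<in> generate G {u}"
        using prime_pow_in_generate[OF finite_carrier prime x] u(2) by blast
      then show False using e(2) Wu by simp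
    qed
  qed (use Wc in auto)
qed

end

section \<open>Descent on the index of a cyclic subgroup\<close>

context normal
begin

text \<open>Elements of \<open>H\<close> become trivial in the quotient, so only the coset of x
  remains as a generator.\<close>

lemma r_coset_generate_insert:
  assumes x: "x \<in> carrier G" and e: "e \<in> generate G (insert x H)"
  shows "H #> e \<in> generate (G Mod H) {H #> x}"
proof -
  interpret h: group_hom G "G Mod H" "(#>) H" by (rule group_hom_r_coset)
  have "insert x H \<subseteq> carrier G" using x subset by auto
  then have "(#>) H ` generate G (insert x H) = generate (G Mod H) ((#>) H ` insert x H)"
    by (rule h.generate_img[symmetric])
  moreover have "generate (G Mod H) ((#>) H ` insert x H) \<subseteq> generate (G Mod H) {H #> x}"
  proof (rule h.H.generate_subgroup_incl)
    show "subgroup (generate (G Mod H) {H #> x}) (G Mod H)"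
      using x by (intro h.H.generate_is_subgroup) auto
    have "H #> k = \<one>\<^bsub>G Mod H\<^esub>" if "k \<in> H" for k
      using that r_coset_eq_iff subset by auto
    then show "(#>) H ` insert x H \<subseteq> generate (G Mod H) {H #> x}"
      using generate.one[of "G Mod H"] by (auto intro: generate.incl)
  qed
  ultimately show ?thesis using e by blast
qed

text \<open>This expresses cyclicity of the quotient inside G: each element of G differs from a
  power of y by a factor in \<open>H\<close>.\<close>

lemma generate_insert_eq_carrier:
  assumes y: "y \<in> carrier G" and gen: "generate (G Mod H) {H #> y} = carrier (G Mod H)"
  shows "generate G (insert y H) = carrier G"
proof
  interpret h: group_hom G "G Mod H" "(#>) H" by (rule group_hom_r_coset)
  show "generate G (insert y H) \<subseteq> carrier G" using y subset by (intro generate_incl) auto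
  show "carrier G \<subseteq> generate G (insert y H)"
  proof
    fix g assume g: "g \<in> carrier G"
    have "H #> g \<in> generate (G Mod H) ((#>) H ` {y})" using gen g by auto
    then have "H #> g \<in> (#>) H ` generate G {y}" using h.generate_img[of "{y}"] y by auto
    then obtain g' where g': "g' \<in> generate G {y}" "H #> g = H #> g'" by auto
    have "g \<in> H #> g'" using g' g rcos_self subgroup_axioms by metis
    then obtain k where k: "k \<in> H" "g = k \<otimes> g'" by (auto simp: r_coset_def)
    have "generate G {y} \<subseteq> generate G (insert y H)" by (rule mono_generate) auto
    then show "g \<in> generate G (insert y H)"
      using g' k by (auto intro: generate.eng generate.incl)
  qed
qed

end

section \<open>Bounds on the lower central series\<close>

context group
begin

lemma lower_central_in_carrier: "lower_central G n \<subseteq> carrier G"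
  by (induction n) (auto intro!: generate_incl)

lemma lower_central_Suc_subset:
  assumes K: "subgroup K G" and n: "lower_central G n \<subseteq> A"
    and comm: "\<And>a g. a \<in> A \<Longrightarrow> g \<in> carrier G \<Longrightarrow> commutator G a g \<in> K"
  shows "lower_central G (Suc n) \<subseteq> K"
  using n comm unfolding lower_central.simps
  by (intro generate_subgroup_incl[OF _ K]) (auto simp: commutator_def subset_iff)

end

context p_group
begin

text \<open>\<open>exists_central_step_outside_cyclic\<close> is applied to G/K, which is noncyclic
  by \<open>noncyc\<close>, and its two subgroups are replaced by their preimages.\<close>

lemma exists_central_step_mod:
  assumes "odd p" and K: "K \<lhd> G" and x: "x \<in> carrier G"
    and noncyc: "\<And>y. y \<in> carrier G \<Longrightarrow> generate G (insert y K) \<noteq> carrier G"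
  obtains D E where "D \<lhd> G" "E \<lhd> G" "K \<subseteq> E" "\<not> E \<subseteq> generate G (insert x K)"
    "\<And>d g. d \<in> D \<Longrightarrow> g \<in> carrier G \<Longrightarrow> commutator G d g \<in> K"
    "\<And>e g. e \<in> E \<Longrightarrow> g \<in> carrier G \<Longrightarrow> commutator G e g \<in> D"
proof -
  interpret K: normal K G by (rule K)
  have hom: "group_hom G (G Mod K) ((#>) K)" by (rule K.group_hom_r_coset)
  interpret h: group_hom G "G Mod K" "(#>) K" by (rule hom)
  obtain m where "p_group (G Mod K) p m" using p_group_Mod[OF K] by blast
  then interpret Q: p_group "G Mod K" p m .
  have "generate (G Mod K) {Y} \<noteq> carrier (G Mod K)" if "Y \<in> carrier (G Mod K)" for Y
    using that K.generate_insert_eq_carrier noncyc by (auto simp: carrier_FactGroup)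
  then obtain D E where D: "D \<lhd> G Mod K" and E: "E \<lhd> G Mod K" "\<not> E \<subseteq> generate (G Mod K) {K #> x}"
    and Dc: "\<And>d g. d \<in> D \<Longrightarrow> g \<in> carrier (G Mod K) \<Longrightarrow> commutator (G Mod K) d g = \<one>\<^bsub>G Mod K\<^esub>"
    and Ec: "\<And>e g. e \<in> E \<Longrightarrow> g \<in> carrier (G Mod K) \<Longrightarrow> commutator (G Mod K) e g \<in> D"
    using Q.exists_central_step_outside_cyclic[OF \<open>odd p\<close> _ h.hom_closed[OF x]] by metis
  interpret E: normal E "G Mod K" by (rule E(1))
  let ?VD = "{g \<in> carrier G. K #> g \<in> D}"
  let ?VE = "{g \<in> carrier G. K #> g \<in> E}"
  show ?thesis
  proof (rule that[of "?VD" "?VE"])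
    show "?VD \<lhd> G" "?VE \<lhd> G" using normal_vimage[OF hom] D E(1) by auto
    have "K #> k \<in> E" if "k \<in> K" for k
      using that K.r_coset_eq_iff[of k] K.subset E.one_closed by auto
    then show "K \<subseteq> ?VE" using K.subset by blast
    show "\<not> ?VE \<subseteq> generate G (insert x K)"
    proof
      assume sub: "?VE \<subseteq> generate G (insert x K)"
      have "Y \<in> generate (G Mod K) {K #> x}" if Y: "Y \<in> E" for Y
      proof -
        obtain y where "y \<in> carrier G" "Y = K #> y" using Y E.subset by (auto simp: carrier_FactGroup)
        then show ?thesis using sub Y K.r_coset_generate_insert[OF x] by auto
      qed
      then show False using E(2) by blast
    qed
    show "commutator G d g \<in> K" if d: "d \<in> ?VD" and g: "g \<in> carrier G" for d g
    proof -
      have dG: "d \<in> carrier G" using d by auto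
      have "K #> commutator G d g = K"
        using Dc[of "K #> d" "K #> g"] d g by (simp add: hom_commutator[OF hom dG g])
      then show ?thesis using dG g K.r_coset_eq_iff by simp
    qed
    show "commutator G e g \<in> ?VD" if e: "e \<in> ?VE" and g: "g \<in> carrier G" for e g
    proof -
      have eG: "e \<in> carrier G" using e by auto
      show ?thesis
        using Ec[of "K #> e" "K #> g"] e g by (simp add: hom_commutator[OF hom eG g])
    qed
  qed
qed

text \<open>Both orders are powers of \<open>p\<close>, so a strict increase is at least by the
  factor p.\<close>

lemma p_mult_card_le:
  assumes "subgroup H G" "subgroup H' G" "H \<subset> H'"
  shows "p * card H \<le> card H'"
proof -
  obtain i where i: "card H = p ^ i" using card_subgroup[OF assms(1)] by blast
  obtain j where j: "card H' = p ^ j" using card_subgroup[OF assms(2)] by blast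
  have "card H < card H'"
    using assms finite_subset[OF subgroup.subset finite_carrier] psubset_card_mono by metis
  then have "i < j" using i j prime_gt_1_nat[OF prime] by simp
  then have "p ^ Suc i \<le> p ^ j" using prime_gt_0_nat[OF prime] by (intro power_increasing) auto
  then show ?thesis using i j by simp
qed

text \<open>The hypothesis says that x generates a subgroup of index at most p^f in G/K. The index
  is only bounded, because passing from K to E may lower it by more than the factor p.\<close>

lemma lower_central_subset_of_index:
  assumes "odd p" and x: "x \<in> carrier G"
  shows "f \<ge> 1 \<Longrightarrow> K \<lhd> G \<Longrightarrow> order G \<le> p ^ f * card (generate G (insert x K))
    \<Longrightarrow> lower_central G (2 * f) \<subseteq> K"
proof (induction f arbitrary: K)
  case 0
  then show ?case by simp
next
  case (Suc f)
  note K = \<open>K \<lhd> G\<close>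
  interpret K: normal K G by (rule K)
  \<comment> \<open>If G/E is cyclic and [E, G] lies in D, then G/D is cyclic modulo a central
    subgroup and hence abelian.\<close>
  have comm_gen: "commutator G g h \<in> D"
    if D: "D \<lhd> G" and "E \<lhd> G" and y: "y \<in> carrier G" and gen: "generate G (insert y E) = carrier G"
      and Ec: "\<And>e g. e \<in> E \<Longrightarrow> g \<in> carrier G \<Longrightarrow> commutator G e g \<in> D"
      and gh: "g \<in> carrier G" "h \<in> carrier G" for D E y g h
  proof -
    interpret D: normal D G by (rule D)
    interpret E: normal E G by fact
    have cE: "commutator G g e \<in> D" if "e \<in> E" "g \<in> carrier G" for e g
      using commutator_in_sym[OF D.subgroup_axioms _ that(2) Ec[OF that]] that E.subset by blast
    show ?thesis
    proof (rule commutator_generate_in[OF D])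
      show "insert y E \<subseteq> carrier G" using y E.subset by auto
      show "g \<in> generate G (insert y E)" "h \<in> generate G (insert y E)" using gh gen by auto
      fix s t assume st: "s \<in> insert y E" "t \<in> insert y E"
      then have "s \<in> carrier G" "t \<in> carrier G" using y E.subset by auto
      then show "commutator G s t \<in> D"
        using st cE Ec y D.one_closed by (metis commutator_self insert_iff)
    qed
  qed
  show ?case
  proof (cases "\<exists>y\<in>carrier G. generate G (insert y K) = carrier G")
    case True
    then obtain y where y: "y \<in> carrier G" "generate G (insert y K) = carrier G" by blast
    \<comment> \<open>G/K is abelian by \<open>comm_gen\<close> with K for both D and E, so every
      term after the first lies in K.\<close>
    have "lower_central G (Suc (Suc (2 * f))) \<subseteq> K"
      using comm_gen[OF K K y normal_commutator_in[OF K]]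
      by (intro lower_central_Suc_subset[OF K.subgroup_axioms lower_central_in_carrier])
    then show ?thesis by simp
  next
    case False
    then obtain D E where D: "D \<lhd> G" and E: "E \<lhd> G" "K \<subseteq> E" "\<not> E \<subseteq> generate G (insert x K)"
      and Dc: "\<And>d g. d \<in> D \<Longrightarrow> g \<in> carrier G \<Longrightarrow> commutator G d g \<in> K"
      and Ec: "\<And>e g. e \<in> E \<Longrightarrow> g \<in> carrier G \<Longrightarrow> commutator G e g \<in> D"
      using exists_central_step_mod[OF \<open>odd p\<close> K x] by metis
    interpret D: normal D G by (rule D)
    interpret E: normal E G by (rule E(1))
    let ?H = "generate G (insert x K)" and ?H' = "generate G (insert x E)"
    have subs: "subgroup ?H G" "subgroup ?H' G"
      using x K.subset E.subset by (auto intro!: generate_is_subgroup)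
    have "?H \<subseteq> ?H'" using E(2) by (intro mono_generate) auto
    moreover have "E \<subseteq> ?H'" by (auto intro: generate.incl)
    ultimately have "?H \<subset> ?H'" using E(3) by auto
    then have "p * card ?H \<le> card ?H'" using p_mult_card_le subs by blast
    \<comment> \<open>Enlarging K to E lowers the index by at least the factor p, so E meets the
      hypothesis with f.\<close>
    then have "p ^ Suc f * card ?H \<le> p ^ f * card ?H'"
      using mult_le_mono2[of "p * card ?H" "card ?H'" "p ^ f"] by (simp only: power_Suc mult_ac)
    then have ord: "order G \<le> p ^ f * card ?H'" using Suc.prems(3) by linarith
    have "lower_central G (Suc (2 * f)) \<subseteq> D"
    proof (cases "f = 0")
      \<comment> \<open>For f = 0 the analogous bound would claim G = E. Instead x generates G
        modulo E, so G/D is abelian, which saves the missing step.\<close>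
      case True
      then have "card (carrier G) \<le> card ?H'" using ord by (simp add: order_def)
      then have "?H' = carrier G"
        using subgroup.subset[OF subs(2)] by (intro card_seteq) auto
      then have "commutator G g h \<in> D" if "g \<in> carrier G" "h \<in> carrier G" for g h
        using comm_gen[OF D E(1) x _ Ec] that by blast
      then show ?thesis
        by (intro lower_central_Suc_subset[OF D.subgroup_axioms lower_central_in_carrier])
    next
      case False
      then have "lower_central G (2 * f) \<subseteq> E" using Suc.IH[OF _ E(1) ord] by simp
      then show ?thesis using Ec by (rule lower_central_Suc_subset[OF D.subgroup_axioms])
    qed
    then have "lower_central G (Suc (Suc (2 * f))) \<subseteq> K"
      using Dc by (rule lower_central_Suc_subset[OF K.subgroup_axioms])
    then show ?thesis by simp
  qed
qed

section \<open>From the coexponent to the bound on the class\<close>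

text \<open>The trivial subgroup is cyclic of index p^n, so the \<open>LEAST\<close> in
  \<open>coexponent\<close> is attained. Lagrange turns the index into an equation for the
  order.\<close>

lemma exists_cyclic_index_coexponent:
  obtains x where "x \<in> carrier G" "order G = p ^ coexponent p G * card (generate G {x})"
proof -
  let ?R = "\<lambda>k. \<exists>C. subgroup C G \<and> cyclic_group (G\<lparr>carrier := C\<rparr>) \<and> card (rcosets C) = p ^ k"
  have triv: "subgroup {\<one>} G" by (rule triv_subgroup)
  have "trivial_group (G\<lparr>carrier := {\<one>}\<rparr>)"
    using subgroup.subgroup_is_group[OF triv is_group] by (simp add: trivial_group_def)
  moreover have "card (rcosets {\<one>}) = p ^ n"
    using lagrange[OF triv] by (simp add: order_eq)
  ultimately have "?R n" using triv trivial_imp_cyclic_group by blast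
  then have "?R (coexponent p G)" unfolding coexponent_def by (rule LeastI)
  then obtain C where C: "subgroup C G" "cyclic_group (G\<lparr>carrier := C\<rparr>)"
      "card (rcosets C) = p ^ coexponent p G" by blast
  obtain x where x: "x \<in> C" "subgroup_generated (G\<lparr>carrier := C\<rparr>) {x} = G\<lparr>carrier := C\<rparr>"
    using C(2) by (auto simp: cyclic_group_def)
  have "carrier (subgroup_generated (G\<lparr>carrier := C\<rparr>) {x}) = C" using x(2) by simp
  then have "generate (G\<lparr>carrier := C\<rparr>) {x} = C"
    using x(1) by (simp add: carrier_subgroup_generated)
  then have "generate G {x} = C" using generate_consistent[of "{x}" C] x(1) C(1) by simp
  then show ?thesis
    using that[of x] lagrange[OF C(1)] C(3) x(1) subgroup.subset[OF C(1)] by auto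
qed

end

theorem theorem1:
  fixes P :: "('a, 'b) monoid_scheme" and p n :: nat
  assumes "Factorial_Ring.prime p" and "odd p"
    and "group P" and "finite (carrier P)" and "order P = p ^ n"
    and "coexponent p P \<ge> 1"
  shows "nilpotency_class P \<le> 2 * coexponent p P"
proof -
  interpret p_group P p n
    using assms by (simp add: p_group_def p_group_axioms_def)
  obtain x where x: "x \<in> carrier P" "order P = p ^ coexponent p P * card (generate P {x})"
    by (rule exists_cyclic_index_coexponent)
  \<comment> \<open>The descent is applied to the trivial subgroup, and adjoining the identity to x
    does not shrink the generated subgroup.\<close>
  have "card (generate P {x}) \<le> card (generate P (insert x {\<one>\<^bsub>P\<^esub>}))"
    using x(1) generate_incl[of "insert x {\<one>\<^bsub>P\<^esub>}"]
    by (intro card_mono mono_generate finite_subset[OF _ finite_carrier]) auto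
  then have "lower_central P (2 * coexponent p P) \<subseteq> {\<one>\<^bsub>P\<^esub>}"
    using x(2) assms by (intro lower_central_subset_of_index[OF \<open>odd p\<close> x(1)] one_is_normal) auto
  moreover have "\<one>\<^bsub>P\<^esub> \<in> lower_central P m" for m
    by (cases m) (auto intro: generate.one)
  ultimately have "lower_central P (2 * coexponent p P) = {\<one>\<^bsub>P\<^esub>}" by blast
  then show ?thesis unfolding nilpotency_class_def by (rule Least_le)
qed

end
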